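(* Let $\mathcal{S}$ be a product approximation operator $\mathcal{S}(\mathbf{A})=\mathcal{S}_1(\mathbf{A}_1)\mathcal{S}_2(\mathbf{A}_2)$ on the product space $\mathsf{M}$ of the matrix classes $\mathsf{M}_1$ and $\mathsf{M}_2$. 1. If $\mathcal{S}_1$ and $\mathcal{S}_2$ commute with the determinant, then $\mathcal{S}$ also commutes with the determinant. 2. If $\mathcal{S}_1$ and $\mathcal{S}_2$ are homogeneous, then so is $\mathcal{S}$.
   Context: Product space: $\mathsf{M},\mathsf{M}_1,\mathsf{M}_2$ are matrix classes such that every $A\in\mathsf{M}$ has a unique decomposition $A=A_1A_2$ with $A_1\in\mathsf{M}_1$, $A_2\in\mathsf{M}_2$. To emphasize the order of the (square) matrices in a class one writes $\mathsf{M}(n)$ for its $n\times n$ matrices; $\mathsf{M}(1)$ is then a set of scalars. Operators: let $\mathtt{I}\subset\mathbb{R}$ be a compact interval. An approximation operator on a class maps a sequence $\mathbf{A}=\{A^{(i)}\}_{i\in\mathcal{J}}$, $\mathcal{J}\subset\mathbb{Z}$, of matrices from the class to a function from $\mathtt{I}$ to the class. Here $\mathcal{S}_j$ is an approximation operator on $\mathsf{M}_j$, $j=1,2$. For $\mathbf{A}$ in $\mathsf{M}$ with $A^{(i)}=A^{(i)}_1A^{(i)}_2$, put $\mathbf{A}_j=\{A_j^{(i)}\}_{i\in\mathcal{J}}$; the product operator on $\mathsf{M}$ is the pointwise matrix product $\mathcal{S}(\mathbf{A})(t)=\mathcal{S}_1(\mathbf{A}_1)(t)\,\mathcal{S}_2(\mathbf{A}_2)(t)$.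 Commuting with the determinant: an operator $\mathcal{S}$ defined on a class of matrices $\mathsf{M}=\mathsf{M}(n)$ of a given order $n$ commutes with the determinant if (i) $\det(M)\in\mathsf{M}(1)$ for any $M\in\mathsf{M}(n)$, and (ii) $\mathcal{S}(\det(\mathbf{A}))(t)=\det(\mathcal{S}(\mathbf{A})(t))$ for each $t\in\mathtt{I}$, where $\det(\mathbf{A})=\{\det(A^{(i)})\}_{i\in\mathcal{J}}$. Homogeneity: let $\mathcal{S}$ be an operator defined on a class of matrices $\mathsf{M}=\mathsf{M}(n)$ of any order $n$, and let $\boldsymbol{\alpha}=\{\alpha^{(i)}\}_{i\in\mathcal{J}}$ be such that $\boldsymbol{\alpha}\subset\mathsf{M}(1)$ and $\boldsymbol{\alpha}\mathbf{A}=\{\alpha^{(i)}A^{(i)}\}\subset\mathsf{M}(n)$. $\mathcal{S}$ is homogeneous if $\mathcal{S}(\boldsymbol{\alpha}\mathbf{A})(t)=\mathcal{S}(\boldsymbol{\alpha})(t)\,\mathcal{S}(\mathbf{A})(t)$ for any $t\in\mathtt{I}$.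
   Formalization: Added: M(n) contains all products A1A2 with Aj in Mj(n); in item 2, whenever c1c2A1A2 is in M(n) (cj in Mj(1), Aj in Mj(n)), each cjAj lies in Mj(n). Without these, the respective items fail for some classes. *)

theory Defs
  imports "Jordan_Normal_Form.Determinant" "HOL-Library.FuncSet"
begin

text \<open>
  A matrix class is a set of square matrices of arbitrary positive orders. The entries are taken
  from an arbitrary field, so that real and complex matrices are both covered.
\<close>

definition matrix_class :: "'a::field mat set \<Rightarrow> bool" where
  "matrix_class M \<longleftrightarrow> (\<forall>A\<in>M. \<exists>n\<ge>1. A \<in> carrier_mat n n)"

definition of_order :: "'a::field mat set \<Rightarrow> nat \<Rightarrow> 'a mat set" where
  "of_order M n = M \<inter> carrier_mat n n"

text \<open>
  Scalars and matrices of order 1 have different types; \<open>scalar_mat\<close> is the identification, and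
  \<open>scalars M\<close> is \<open>of_order M 1\<close> regarded as a set of scalars.
\<close>

definition scalar_mat :: "'a::field \<Rightarrow> 'a mat" where
  "scalar_mat c = mat 1 1 (\<lambda>_. c)"

definition scalars :: "'a::field mat set \<Rightarrow> 'a set" where
  "scalars M = {c. scalar_mat c \<in> of_order M 1}"

text \<open>
  As the target of product operators, a product space contains all products of members of the two
  factor classes, besides every member having a unique decomposition.
\<close>

definition product_space :: "'a::field mat set \<Rightarrow> 'a mat set \<Rightarrow> 'a mat set \<Rightarrow> bool" where
  "product_space M M1 M2 \<longleftrightarrow>
     matrix_class M \<and> matrix_class M1 \<and> matrix_class M2 \<and>
     (\<forall>n. \<forall>A\<in>of_order M n. \<exists>!p. p \<in> of_order M1 n \<times> of_order M2 n \<and> A = fst p * snd p) \<and>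
     (\<forall>n. \<forall>A1\<in>of_order M1 n. \<forall>A2\<in>of_order M2 n. A1 * A2 \<in> of_order M n)"

definition factors :: "'a::field mat set \<Rightarrow> 'a mat set \<Rightarrow> 'a mat \<Rightarrow> 'a mat \<times> 'a mat" where
  "factors M1 M2 A =
     (THE p. p \<in> of_order M1 (dim_row A) \<times> of_order M2 (dim_row A) \<and> A = fst p * snd p)"

text \<open>
  A sequence indexed by \<open>J\<close> is a function in \<open>J \<rightarrow>\<^sub>E of_order M n\<close>, that is, one
  that is undefined outside \<open>J\<close>; so an operator can only depend on the entries with index in \<open>J\<close>.
\<close>

type_synonym 'a operator = "(int \<Rightarrow> 'a mat) \<Rightarrow> real \<Rightarrow> 'a mat"

definition approximation_operator ::
    "real set \<Rightarrow> int set \<Rightarrow> 'a::field mat set \<Rightarrow> 'a operator \<Rightarrow> bool" where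
  "approximation_operator I J M S \<longleftrightarrow>
     (\<forall>n\<ge>1. \<forall>A \<in> J \<rightarrow>\<^sub>E of_order M n. \<forall>t\<in>I. S A t \<in> of_order M n)"

definition product_operator ::
    "int set \<Rightarrow> 'a::field mat set \<Rightarrow> 'a mat set \<Rightarrow> 'a operator \<Rightarrow> 'a operator \<Rightarrow> 'a operator" where
  "product_operator J M1 M2 S1 S2 = (\<lambda>A t.
     S1 (\<lambda>i\<in>J. fst (factors M1 M2 (A i))) t * S2 (\<lambda>i\<in>J. snd (factors M1 M2 (A i))) t)"

definition commutes_with_det ::
    "real set \<Rightarrow> int set \<Rightarrow> 'a::field mat set \<Rightarrow> nat \<Rightarrow> 'a operator \<Rightarrow> bool" where
  "commutes_with_det I J M n S \<longleftrightarrow>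
     (\<forall>A \<in> of_order M n. det A \<in> scalars M) \<and>
     (\<forall>A \<in> J \<rightarrow>\<^sub>E of_order M n. \<forall>t\<in>I.
        S (\<lambda>i\<in>J. scalar_mat (det (A i))) t = scalar_mat (det (S A t)))"

text \<open>
  The value of \<open>S\<close> on a sequence of scalars is a matrix of order 1, acting as the scalar that is
  its only entry.
\<close>

definition homogeneous ::
    "real set \<Rightarrow> int set \<Rightarrow> 'a::field mat set \<Rightarrow> nat \<Rightarrow> 'a operator \<Rightarrow> bool" where
  "homogeneous I J M n S \<longleftrightarrow>
     (\<forall>\<alpha> \<in> J \<rightarrow>\<^sub>E scalars M. \<forall>A \<in> J \<rightarrow>\<^sub>E of_order M n.
        (\<forall>i\<in>J. \<alpha> i \<cdot>\<^sub>m A i \<in> of_order M n) \<longrightarrow>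
        (\<forall>t\<in>I. S (\<lambda>i\<in>J. \<alpha> i \<cdot>\<^sub>m A i) t =
                (S (\<lambda>i\<in>J. scalar_mat (\<alpha> i)) t $$ (0, 0)) \<cdot>\<^sub>m S A t))"

text \<open>
  Whenever a scalar multiple of a member of the product space stays in the space, the
  corresponding multiples of its factors stay in the factor classes. This holds, for instance, if
  each factor class is closed under multiplication by its own scalars. Homogeneity
  of the factor operators does not give homogeneity of the product operator without it.
\<close>

definition factorwise_scaling ::
    "'a::field mat set \<Rightarrow> 'a mat set \<Rightarrow> 'a mat set \<Rightarrow> nat \<Rightarrow> bool" where
  "factorwise_scaling M M1 M2 n \<longleftrightarrow>
     (\<forall>c1\<in>scalars M1. \<forall>c2\<in>scalars M2. \<forall>A1\<in>of_order M1 n. \<forall>A2\<in>of_order M2 n.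
        (c1 * c2) \<cdot>\<^sub>m (A1 * A2) \<in> of_order M n \<longrightarrow>
        c1 \<cdot>\<^sub>m A1 \<in> of_order M1 n \<and> c2 \<cdot>\<^sub>m A2 \<in> of_order M2 n)"

end

theory Submission
  imports Defs
begin

text \<open>
  A product operator never sees anything but the factors of its argument, and these are unique. So
  if an operation on members of the product space (taking determinants, multiplying by scalars) can
  be carried out on the factors without leaving the factor classes, then the result of
  doing so must be the decomposition that the product operator finds: it acts
  on a sequence \<open>A1 i * A2 i\<close> by \<open>S1 A1 t * S2 A2 t\<close>, whichever way the sequences \<open>A1\<close> and \<open>A2\<close> in
  the factor classes were obtained (\<open>product_operator_mult\<close>). Both claims are instances.

  The determinant is multiplicative, so \<open>det A\<close> has the factors \<open>det A1\<close> and \<open>det A2\<close>, which lie in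
  the factor classes at order 1. Each factor operator commutes with \<open>det\<close>, and multiplicativity is
  used again to reassemble \<open>det (S1 A1 t) * det (S2 A2 t)\<close>.

  A scalar in the product space is itself a product of scalars \<open>c1\<close> and \<open>c2\<close> from the
  factor classes, so the scaled matrix is \<open>(c1 A1) (c2 A2)\<close>. The scaling
  condition on the classes says that this is its decomposition, and homogeneity of
  each factor operator pulls out the values at \<open>c1\<close> and \<open>c2\<close>. Their product is the value of the
  product operator at the given scalars.
\<close>

section \<open>Scalars as matrices of order 1\<close>

lemma scalar_mat_carrier [simp]: "scalar_mat c \<in> carrier_mat 1 1"
  by (simp add: scalar_mat_def)

lemma scalar_mat_entry [simp]: "scalar_mat c $$ (0, 0) = c"
  by (simp add: scalar_mat_def)

lemma scalar_mat_of_entry: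
  assumes "X \<in> carrier_mat 1 1"
  shows "scalar_mat (X $$ (0, 0)) = X"
  using assms by (intro eq_matI) (auto simp: scalar_mat_def)

lemma scalar_mat_mult: "scalar_mat (c * d) = scalar_mat c * scalar_mat d"
  by (rule eq_matI) (auto simp: scalar_mat_def scalar_prod_def)

lemma entry_mult_order_1:
  assumes "X \<in> carrier_mat 1 1" and "Y \<in> carrier_mat 1 1"
  shows "(X * Y) $$ (0, 0) = X $$ (0, 0) * Y $$ (0, 0)"
  using assms by (auto simp: scalar_prod_def)

lemma scalars_iff: "c \<in> scalars M \<longleftrightarrow> scalar_mat c \<in> of_order M 1"
  by (simp add: scalars_def)

section \<open>Decomposition in a product space\<close>

lemma of_order_carrier: "A \<in> of_order M n \<Longrightarrow> A \<in> carrier_mat n n"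
  by (simp add: of_order_def)

lemma product_space_mult_closed:
  assumes "product_space M M1 M2" and "A1 \<in> of_order M1 n" and "A2 \<in> of_order M2 n"
  shows "A1 * A2 \<in> of_order M n"
proof -
  have "\<forall>n. \<forall>A1\<in>of_order M1 n. \<forall>A2\<in>of_order M2 n. A1 * A2 \<in> of_order M n"
    using assms(1) unfolding product_space_def by (elim conjE)
  from this[rule_format, OF assms(2,3)] show ?thesis .
qed

lemma product_space_unique:
  assumes "product_space M M1 M2" and "A \<in> of_order M n"
  shows "\<exists>!p. p \<in> of_order M1 n \<times> of_order M2 n \<and> A = fst p * snd p"
proof -
  have "\<forall>n. \<forall>A\<in>of_order M n.
      \<exists>!p. p \<in> of_order M1 n \<times> of_order M2 n \<and> A = fst p * snd p"
    using assms(1) unfolding product_space_def by (elim conjE)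
  from this[rule_format, OF assms(2)] show ?thesis .
qed

lemma product_space_decompose:
  assumes "product_space M M1 M2" and "A \<in> of_order M n"
  obtains A1 A2 where "A1 \<in> of_order M1 n" "A2 \<in> of_order M2 n" "A = A1 * A2"
proof -
  obtain p where p: "p \<in> of_order M1 n \<times> of_order M2 n" "A = fst p * snd p"
    using product_space_unique[OF assms, THEN ex1_implies_ex] by (elim exE conjE)
  show thesis
    using p by (intro that[of "fst p" "snd p"]) (simp_all only: mem_Times_iff)
qed

lemma factors_mult:
  assumes ps: "product_space M M1 M2"
    and A1: "A1 \<in> of_order M1 n" and A2: "A2 \<in> of_order M2 n"
  shows "factors M1 M2 (A1 * A2) = (A1, A2)"
proof -
  have "dim_row (A1 * A2) = n"
    using of_order_carrier[OF A1] by simp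
  moreover have "\<exists>!p. p \<in> of_order M1 n \<times> of_order M2 n \<and> A1 * A2 = fst p * snd p"
    using ps product_space_mult_closed[OF assms] by (rule product_space_unique)
  ultimately show ?thesis
    unfolding factors_def using A1 A2 by (intro the1_equality) auto
qed

lemma scalars_mult_closed:
  assumes "product_space M M1 M2" and "c1 \<in> scalars M1" and "c2 \<in> scalars M2"
  shows "c1 * c2 \<in> scalars M"
  using assms by (simp add: scalars_iff scalar_mat_mult product_space_mult_closed)

lemma scalars_decompose:
  assumes ps: "product_space M M1 M2" and c: "c \<in> scalars M"
  obtains c1 c2 where "c1 \<in> scalars M1" "c2 \<in> scalars M2" "c = c1 * c2"
proof -
  obtain X Y where X: "X \<in> of_order M1 1" and Y: "Y \<in> of_order M2 1"
    and eq: "scalar_mat c = X * Y"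
    using product_space_decompose[OF ps c[unfolded scalars_iff]] .
  have carrier: "X \<in> carrier_mat 1 1" "Y \<in> carrier_mat 1 1"
    using X Y by (auto dest: of_order_carrier)
  show thesis
  proof
    show "X $$ (0, 0) \<in> scalars M1" "Y $$ (0, 0) \<in> scalars M2"
      using X Y carrier by (simp_all add: scalars_iff scalar_mat_of_entry)
    show "c = X $$ (0, 0) * Y $$ (0, 0)"
      using eq carrier entry_mult_order_1[of X Y] by (simp flip: eq)
  qed
qed

text \<open>
  One statement for sequences of matrices and for sequences of scalars: members of a set in which
  everything splits can be split simultaneously, by choice, into extensional sequences.
\<close>

lemma split_sequence:
  assumes A: "A \<in> J \<rightarrow>\<^sub>E X"
    and split: "\<And>x. x \<in> X \<Longrightarrow> \<exists>y\<in>Y. \<exists>z\<in>Z. x = f y z"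
  obtains B C where "B \<in> J \<rightarrow>\<^sub>E Y" "C \<in> J \<rightarrow>\<^sub>E Z" "A = (\<lambda>i\<in>J. f (B i) (C i))"
proof -
  have "\<forall>i\<in>J. \<exists>y z. y \<in> Y \<and> z \<in> Z \<and> A i = f y z"
    using A split by (meson PiE_mem)
  then obtain B C where BC: "\<And>i. i \<in> J \<Longrightarrow> B i \<in> Y \<and> C i \<in> Z \<and> A i = f (B i) (C i)"
    by metis
  show thesis
  proof
    show "restrict B J \<in> J \<rightarrow>\<^sub>E Y" "restrict C J \<in> J \<rightarrow>\<^sub>E Z"
      using BC by auto
    show "A = (\<lambda>i\<in>J. f (restrict B J i) (restrict C J i))"
      using A BC by (intro extensionalityI[of A J]) (auto simp: PiE_def)
  qed
qed

lemma decompose_matrix_sequence: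
  assumes "product_space M M1 M2" and "A \<in> J \<rightarrow>\<^sub>E of_order M n"
  obtains A1 A2 where "A1 \<in> J \<rightarrow>\<^sub>E of_order M1 n" "A2 \<in> J \<rightarrow>\<^sub>E of_order M2 n"
    "A = (\<lambda>i\<in>J. A1 i * A2 i)"
proof (rule split_sequence[OF assms(2), of "of_order M1 n" "of_order M2 n" "(*)"])
  show "\<exists>B\<in>of_order M1 n. \<exists>C\<in>of_order M2 n. X = B * C" if "X \<in> of_order M n" for X
    using product_space_decompose[OF assms(1) that] by blast
qed (rule that)

lemma decompose_scalar_sequence:
  assumes "product_space M M1 M2" and "\<alpha> \<in> J \<rightarrow>\<^sub>E scalars M"
  obtains \<alpha>1 \<alpha>2 where "\<alpha>1 \<in> J \<rightarrow>\<^sub>E scalars M1" "\<alpha>2 \<in> J \<rightarrow>\<^sub>E scalars M2"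
    "\<alpha> = (\<lambda>i\<in>J. \<alpha>1 i * \<alpha>2 i)"
proof (rule split_sequence[OF assms(2), of "scalars M1" "scalars M2" "(*)"])
  show "\<exists>d\<in>scalars M1. \<exists>e\<in>scalars M2. c = d * e" if "c \<in> scalars M" for c
    using scalars_decompose[OF assms(1) that] by blast
qed (rule that)

section \<open>The product operator on factored sequences\<close>

lemma approximation_operator_carrier:
  assumes "approximation_operator I J M S" and "n \<ge> 1"
    and "A \<in> J \<rightarrow>\<^sub>E of_order M n" and "t \<in> I"
  shows "S A t \<in> carrier_mat n n"
  using assms unfolding approximation_operator_def by (blast intro: of_order_carrier)

text \<open>
  This replaces the factors chosen inside the product operator by any explicitly known ones, and is
  the place where uniqueness of the decomposition enters.
\<close>

lemma product_operator_mult: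
  assumes ps: "product_space M M1 M2"
    and A1: "A1 \<in> J \<rightarrow>\<^sub>E of_order M1 n" and A2: "A2 \<in> J \<rightarrow>\<^sub>E of_order M2 n"
  shows "product_operator J M1 M2 S1 S2 (\<lambda>i\<in>J. A1 i * A2 i) t = S1 A1 t * S2 A2 t"
proof -
  have "factors M1 M2 (A1 i * A2 i) = (A1 i, A2 i)" if "i \<in> J" for i
    using ps A1 A2 that by (intro factors_mult) (auto dest: PiE_mem)
  then have "(\<lambda>i\<in>J. fst (factors M1 M2 ((\<lambda>i\<in>J. A1 i * A2 i) i))) = A1"
    and "(\<lambda>i\<in>J. snd (factors M1 M2 ((\<lambda>i\<in>J. A1 i * A2 i) i))) = A2"
    using A1 A2 by (auto simp: PiE_def intro!: extensionalityI[of _ J])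
  then show ?thesis
    unfolding product_operator_def by simp
qed

text \<open>
  The same at order 1. The sequences are arbitrary outside \<open>J\<close>, as are those that arise
  from determinants.
\<close>

lemma product_operator_scalar_mult:
  assumes ps: "product_space M M1 M2"
    and "\<And>i. i \<in> J \<Longrightarrow> c1 i \<in> scalars M1" and "\<And>i. i \<in> J \<Longrightarrow> c2 i \<in> scalars M2"
  shows "product_operator J M1 M2 S1 S2 (\<lambda>i\<in>J. scalar_mat (c1 i * c2 i)) t =
    S1 (\<lambda>i\<in>J. scalar_mat (c1 i)) t * S2 (\<lambda>i\<in>J. scalar_mat (c2 i)) t"
proof -
  have "(\<lambda>i\<in>J. scalar_mat (c1 i)) \<in> J \<rightarrow>\<^sub>E of_order M1 1"
    and "(\<lambda>i\<in>J. scalar_mat (c2 i)) \<in> J \<rightarrow>\<^sub>E of_order M2 1"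
    using assms by (auto simp: scalars_iff)
  from product_operator_mult[OF ps this, of S1 S2 t] show ?thesis
    by (simp add: scalar_mat_mult cong: restrict_cong)
qed

section \<open>Inheritance by the product operator\<close>

lemma commutes_with_det_product_operator:
  assumes ps: "product_space M M1 M2"
    and op1: "approximation_operator I J M1 S1" and op2: "approximation_operator I J M2 S2"
    and n: "n \<ge> 1"
    and det1: "commutes_with_det I J M1 n S1" and det2: "commutes_with_det I J M2 n S2"
  shows "commutes_with_det I J M n (product_operator J M1 M2 S1 S2)"
  unfolding commutes_with_det_def
proof (intro conjI ballI)
  note det_in = det1[unfolded commutes_with_det_def, THEN conjunct1, rule_format]
    det2[unfolded commutes_with_det_def, THEN conjunct1, rule_format]
  note det_eq = det1[unfolded commutes_with_det_def, THEN conjunct2, rule_format]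
    det2[unfolded commutes_with_det_def, THEN conjunct2, rule_format]
  {
    fix A assume "A \<in> of_order M n"
    then obtain A1 A2 where A1: "A1 \<in> of_order M1 n" and A2: "A2 \<in> of_order M2 n"
      and A: "A = A1 * A2"
      by (rule product_space_decompose[OF ps])
    have "det A = det A1 * det A2"
      unfolding A using A1 A2 by (intro det_mult) (auto dest: of_order_carrier)
    then show "det A \<in> scalars M"
      using scalars_mult_closed[OF ps det_in(1)[OF A1] det_in(2)[OF A2]] by simp
  next
    fix A t assume "A \<in> J \<rightarrow>\<^sub>E of_order M n" and t: "t \<in> I"
    then obtain A1 A2 where A1: "A1 \<in> J \<rightarrow>\<^sub>E of_order M1 n" and A2: "A2 \<in> J \<rightarrow>\<^sub>E of_order M2 n"
      and A: "A = (\<lambda>i\<in>J. A1 i * A2 i)"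
      by - (rule decompose_matrix_sequence[OF ps])
    let ?S = "product_operator J M1 M2 S1 S2"
    have in1: "A1 i \<in> of_order M1 n" and in2: "A2 i \<in> of_order M2 n" if "i \<in> J" for i
      using that A1 A2 by (auto dest: PiE_mem)
    have "det (A i) = det (A1 i) * det (A2 i)" if "i \<in> J" for i
      using that of_order_carrier[OF in1[OF that]] of_order_carrier[OF in2[OF that]]
      by (simp add: A det_mult)
    then have "?S (\<lambda>i\<in>J. scalar_mat (det (A i))) t =
        ?S (\<lambda>i\<in>J. scalar_mat (det (A1 i) * det (A2 i))) t"
      by (simp cong: restrict_cong)
    also have "\<dots> = S1 (\<lambda>i\<in>J. scalar_mat (det (A1 i))) t * S2 (\<lambda>i\<in>J. scalar_mat (det (A2 i))) t"
      using ps det_in(1)[OF in1] det_in(2)[OF in2] by (rule product_operator_scalar_mult)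
    also have "\<dots> = scalar_mat (det (S1 A1 t) * det (S2 A2 t))"
      by (simp add: det_eq(1)[OF A1 t] det_eq(2)[OF A2 t] scalar_mat_mult)
    also have "det (S1 A1 t) * det (S2 A2 t) = det (S1 A1 t * S2 A2 t)"
      using approximation_operator_carrier[OF op1 n A1 t]
        approximation_operator_carrier[OF op2 n A2 t] by (rule det_mult[symmetric])
    also have "S1 A1 t * S2 A2 t = ?S A t"
      unfolding A using product_operator_mult[OF ps A1 A2] by (rule sym)
    finally show "?S (\<lambda>i\<in>J. scalar_mat (det (A i))) t = scalar_mat (det (?S A t))" .
  }
qed

lemma smult_mult_smult_mat:
  fixes c d :: "'a::comm_semiring_1"
  assumes "X \<in> carrier_mat n n" and "Y \<in> carrier_mat n n"
  shows "(c \<cdot>\<^sub>m X) * (d \<cdot>\<^sub>m Y) = (c * d) \<cdot>\<^sub>m (X * Y)"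
  using assms by (intro eq_matI) (auto simp: ac_simps)

text \<open>
  The scaling condition puts \<open>c1 A1\<close> and \<open>c2 A2\<close> into the factor classes; without that, the scaled
  product could decompose in another way, on which homogeneity of the factor operators says nothing.
\<close>

lemma homogeneous_product_operator:
  assumes ps: "product_space M M1 M2"
    and op1: "approximation_operator I J M1 S1" and op2: "approximation_operator I J M2 S2"
    and n: "n \<ge> 1"
    and scaling: "factorwise_scaling M M1 M2 n"
    and hom1: "homogeneous I J M1 n S1" and hom2: "homogeneous I J M2 n S2"
  shows "homogeneous I J M n (product_operator J M1 M2 S1 S2)"
  unfolding homogeneous_def
proof (intro ballI impI)
  fix \<alpha> A t
  assume \<alpha>_in: "\<alpha> \<in> J \<rightarrow>\<^sub>E scalars M" and A_in: "A \<in> J \<rightarrow>\<^sub>E of_order M n"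
    and \<alpha>A: "\<forall>i\<in>J. \<alpha> i \<cdot>\<^sub>m A i \<in> of_order M n" and t: "t \<in> I"
  obtain A1 A2 where A1: "A1 \<in> J \<rightarrow>\<^sub>E of_order M1 n" and A2: "A2 \<in> J \<rightarrow>\<^sub>E of_order M2 n"
    and A: "A = (\<lambda>i\<in>J. A1 i * A2 i)"
    using decompose_matrix_sequence[OF ps A_in] .
  obtain c1 c2 where c1: "c1 \<in> J \<rightarrow>\<^sub>E scalars M1" and c2: "c2 \<in> J \<rightarrow>\<^sub>E scalars M2"
    and \<alpha>: "\<alpha> = (\<lambda>i\<in>J. c1 i * c2 i)"
    using decompose_scalar_sequence[OF ps \<alpha>_in] .
  let ?S = "product_operator J M1 M2 S1 S2"
  let ?B1 = "\<lambda>i\<in>J. c1 i \<cdot>\<^sub>m A1 i" and ?B2 = "\<lambda>i\<in>J. c2 i \<cdot>\<^sub>m A2 i"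
  let ?s1 = "S1 (\<lambda>i\<in>J. scalar_mat (c1 i)) t" and ?s2 = "S2 (\<lambda>i\<in>J. scalar_mat (c2 i)) t"
  have in_class: "A1 i \<in> of_order M1 n" "A2 i \<in> of_order M2 n" "c1 i \<in> scalars M1" "c2 i \<in> scalars M2"
    if "i \<in> J" for i
    using that A1 A2 c1 c2 by (auto dest: PiE_mem)
  have scaled: "c1 i \<cdot>\<^sub>m A1 i \<in> of_order M1 n \<and> c2 i \<cdot>\<^sub>m A2 i \<in> of_order M2 n" if "i \<in> J" for i
  proof -
    have "(c1 i * c2 i) \<cdot>\<^sub>m (A1 i * A2 i) \<in> of_order M n"
      using \<alpha>A that by (auto simp: \<alpha> A)
    then show ?thesis
      using scaling in_class[OF that] unfolding factorwise_scaling_def by blast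
  qed
  have B1: "?B1 \<in> J \<rightarrow>\<^sub>E of_order M1 n" and B2: "?B2 \<in> J \<rightarrow>\<^sub>E of_order M2 n"
    using scaled by auto

  have "\<alpha> i \<cdot>\<^sub>m A i = ?B1 i * ?B2 i" if "i \<in> J" for i
    using that of_order_carrier[OF in_class(1)[OF that]] of_order_carrier[OF in_class(2)[OF that]]
    by (simp add: \<alpha> A smult_mult_smult_mat)
  then have "?S (\<lambda>i\<in>J. \<alpha> i \<cdot>\<^sub>m A i) t = ?S (\<lambda>i\<in>J. ?B1 i * ?B2 i) t"
    by (simp cong: restrict_cong)
  also have "\<dots> = S1 ?B1 t * S2 ?B2 t"
    using ps B1 B2 by (rule product_operator_mult)
  also have "S1 ?B1 t = (?s1 $$ (0, 0)) \<cdot>\<^sub>m S1 A1 t"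
    using scaled by (intro hom1[unfolded homogeneous_def, rule_format] c1 A1 t) simp
  also have "S2 ?B2 t = (?s2 $$ (0, 0)) \<cdot>\<^sub>m S2 A2 t"
    using scaled by (intro hom2[unfolded homogeneous_def, rule_format] c2 A2 t) simp
  also have "(?s1 $$ (0, 0)) \<cdot>\<^sub>m S1 A1 t * ((?s2 $$ (0, 0)) \<cdot>\<^sub>m S2 A2 t) =
      (?s1 $$ (0, 0) * ?s2 $$ (0, 0)) \<cdot>\<^sub>m (S1 A1 t * S2 A2 t)"
    using approximation_operator_carrier[OF op1 n A1 t]
      approximation_operator_carrier[OF op2 n A2 t] by (rule smult_mult_smult_mat)
  also have "?s1 $$ (0, 0) * ?s2 $$ (0, 0) = (?s1 * ?s2) $$ (0, 0)"
  proof (rule entry_mult_order_1[symmetric])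
    show "?s1 \<in> carrier_mat 1 1"
      using in_class t by (intro approximation_operator_carrier[OF op1]) (auto simp: scalars_iff)
    show "?s2 \<in> carrier_mat 1 1"
      using in_class t by (intro approximation_operator_carrier[OF op2]) (auto simp: scalars_iff)
  qed
  also have "?s1 * ?s2 = ?S (\<lambda>i\<in>J. scalar_mat (c1 i * c2 i)) t"
    using product_operator_scalar_mult[OF ps in_class(3,4)] by (rule sym)
  also have "(\<lambda>i\<in>J. scalar_mat (c1 i * c2 i)) = (\<lambda>i\<in>J. scalar_mat (\<alpha> i))"
    by (simp add: \<alpha> cong: restrict_cong)
  also have "S1 A1 t * S2 A2 t = ?S A t"
    unfolding A using product_operator_mult[OF ps A1 A2] by (rule sym)
  finally show "?S (\<lambda>i\<in>J. \<alpha> i \<cdot>\<^sub>m A i) t =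
      (?S (\<lambda>i\<in>J. scalar_mat (\<alpha> i)) t $$ (0, 0)) \<cdot>\<^sub>m ?S A t" .
qed

theorem proposition5p6:
  fixes M M1 M2 :: "'a::field mat set"
    and J :: "int set" and a b :: real
    and S S1 S2 :: "'a operator"
  assumes "a \<le> b"
    and "product_space M M1 M2"
    and "approximation_operator {a..b} J M1 S1"
    and "approximation_operator {a..b} J M2 S2"
    and "S = product_operator J M1 M2 S1 S2"
  shows "(\<forall>n\<ge>1. commutes_with_det {a..b} J M1 n S1 \<and> commutes_with_det {a..b} J M2 n S2 \<longrightarrow>
            commutes_with_det {a..b} J M n S) \<and>
         (\<forall>n\<ge>1. factorwise_scaling M M1 M2 n \<longrightarrow>
            homogeneous {a..b} J M1 n S1 \<and> homogeneous {a..b} J M2 n S2 \<longrightarrow>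
            homogeneous {a..b} J M n S)"
  unfolding assms(5)
  by (intro conjI allI impI; elim conjE)
    (rule commutes_with_det_product_operator[OF assms(2-4)]
      homogeneous_product_operator[OF assms(2-4)]; assumption)+

end
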